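(* Suppose that $\mathcal{C}\subset\mathbb{R}^{n\times n}_+$ is defined as $$\mathcal{C}=\{\mathbf{M}\in\mathbb{R}^{n\times n} \mid \mathbf{M}\ge\mathbf{0},\ \mathbf{g}+\mathcal{L}(\mathbf{M})\in\mathcal{K}\}$$ for a linear operator $\mathcal{L}:\mathbb{R}^{n\times n}\to\mathbb{R}^\ell$, a vector $\mathbf{g}\in\mathbb{R}^\ell$, and a closed convex cone $\mathcal{K}\subset\mathbb{R}^\ell$. Suppose further that $\mathcal{C}$ is compact and that there exists a point that strictly satisfies the nonnegativity and conic constraints. Then the problem of maximizing capacity over $\mathcal{C}$ can be solved via a CGP as follows: $$\sup_{\mathbf{M}\in\mathcal{C}}\mathrm{cap}(p_{\mathbf{M}})=\inf_{\mathbf{x}\in\mathbb{R}^n,\ \boldsymbol{\beta}\in\mathbb{R}^n,\ \boldsymbol{\zeta}\in\mathbb{R}^\ell}\ \exp(\mathbf{g}'\boldsymbol{\zeta}+\mathbf{1}'\boldsymbol{\beta})$$ where the infimum is subject to $$[\mathcal{L}^\dagger(\boldsymbol{\zeta})]_{i,j}+\exp(x_j-\beta_i-1)\le0\ \ \text{for all } i,j=1,\dots,n,\qquad \mathbf{1}'\mathbf{x}=0,\qquad \boldsymbol{\zeta}\in\mathcal{K}^\star.$$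
   Context: Primes denote transposes; $\mathbf{1}$ is the all-ones vector; $\mathbf{M}\ge\mathbf{0}$ is entrywise, and $\mathbb{R}^{n\times n}_+$ is the set of entrywise nonnegative matrices. $\mathcal{L}^\dagger:\mathbb{R}^\ell\to\mathbb{R}^{n\times n}$ is the adjoint of $\mathcal{L}$ (with respect to the Euclidean inner product on $\mathbb{R}^\ell$ and the trace inner product on $\mathbb{R}^{n\times n}$). $\mathcal{K}^\star=\{\boldsymbol{\nu}\in\mathbb{R}^\ell \mid \mathbf{x}'\boldsymbol{\nu}\ge0\ \forall\,\mathbf{x}\in\mathcal{K}\}$ is the dual cone. Strict satisfaction means that all entries of $\mathbf{M}$ are positive and $\mathbf{g}+\mathcal{L}(\mathbf{M})$ lies in the interior of $\mathcal{K}$. For $\mathbf{M}\in\mathbb{R}^{n\times n}_+$, $p_{\mathbf{M}}(y_1,\dots,y_n)=\prod_{i=1}^n\big(\sum_{j=1}^n M_{i,j}y_j\big)$. The capacity of a homogeneous polynomial $p$ of degree $n$ in $\mathbf{y}\in\mathbb{R}^n_+$ (entrywise nonnegative vectors) is $\mathrm{cap}(p)=\inf\{p(\mathbf{y}) \mid \mathbf{y}\in\mathbb{R}^n_+,\ y_1\cdots y_n=1\}$. A conic geometric program (CGP) is the minimization of a linear function of a decision variable subject to affine constraints, membership in a convex cone, and constraints of the form $\exp(\mathbf{q}'\mathbf{x}-s)+\mathbf{r}'\mathbf{x}-t\le0$ with fixed $\mathbf{q},\mathbf{r},s,t$; the objective $\exp(\text{linear})$ above is understood as equivalent to minimizing the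 linear function in the exponent. *)

theory Defs
  imports "HOL-Analysis.Analysis"
begin

definition dual_cone :: "'a::euclidean_space set \<Rightarrow> 'a set" where
  "dual_cone K = {\<nu>. \<forall>x\<in>K. 0 \<le> x \<bullet> \<nu>}"

definition row_product_poly :: "real^'n^'n \<Rightarrow> real^'n \<Rightarrow> real" where
  "row_product_poly M y = (\<Prod>i\<in>UNIV. \<Sum>j\<in>UNIV. M $ i $ j * y $ j)"

text \<open>The capacity, like every other supremum and infimum here, is taken in the extended reals,
  so that its value is meaningful without side conditions on boundedness or nonemptiness.  The
  polynomial is represented by the function it induces.\<close>

definition capacity :: "(real^'n \<Rightarrow> real) \<Rightarrow> ereal" where
  "capacity p = (INF y \<in> {y. (\<forall>i. 0 \<le> y $ i) \<and> (\<Prod>i\<in>UNIV. y $ i) = 1}. ereal (p y))"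

text \<open>Minimizing \<open>f\<close> over \<open>F\<close> is a conic geometric program.  \<open>E\<close> lists the affine constraints,
  \<open>G\<close> the data \<open>(q, r, s, t)\<close> of the exponential constraints.\<close>

definition conic_geometric_program :: "('a::euclidean_space \<Rightarrow> real) \<Rightarrow> 'a set \<Rightarrow> bool" where
  "conic_geometric_program f F \<longleftrightarrow>
     linear f \<and>
     (\<exists>(E :: ('a \<times> real) set) K (G :: ('a \<times> 'a \<times> real \<times> real) set).
        finite E \<and> convex_cone K \<and> finite G \<and>
        F = {z. (\<forall>(a, b)\<in>E. a \<bullet> z = b) \<and> z \<in> K \<and>
                (\<forall>(q, r, s, t)\<in>G. exp (q \<bullet> z - s) + r \<bullet> z - t \<le> 0)})"

text \<open>The inner product on \<^typ>\<open>real^'n^'n\<close> is the sum of the products of the entries, i.e. the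
  trace inner product, so \<^const>\<open>adjoint\<close> is the intended adjoint for linear \<open>L\<close>.\<close>

definition capacity_cgp_feasible ::
  "(real^'n^'n \<Rightarrow> real^'l) \<Rightarrow> (real^'l) set \<Rightarrow> ((real^'n) \<times> (real^'n) \<times> (real^'l)) set" where
  "capacity_cgp_feasible L K =
     {(x, \<beta>, \<zeta>). (\<forall>i j. adjoint L \<zeta> $ i $ j + exp (x $ j - \<beta> $ i - 1) \<le> 0) \<and>
                 1 \<bullet> x = 0 \<and> \<zeta> \<in> dual_cone K}"

end

theory Submission
  imports Defs
begin

text \<open>The proof replaces the capacity by an entropy. For positive \<open>M\<close> and a positive doubly
  stochastic \<open>D\<close>, Jensen's inequality gives
  \<open>(\<Sum>i j. D\<^sub>i\<^sub>j ln (M\<^sub>i\<^sub>j / D\<^sub>i\<^sub>j)) \<le> ln (cap p\<^sub>M)\<close>, and the left side is jointly concave in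
  \<open>(M, D)\<close>. Maximizing it over \<open>M \<in> C\<close> and doubly stochastic \<open>D\<close> is a concave problem with linear
  constraints for which \<open>M\<close> strictly feasible and \<open>D\<close> uniform is a Slater point, so one separating
  hyperplane yields multipliers \<open>\<beta>\<close> (row sums), \<open>x\<close> (column sums) and \<open>\<zeta>\<close> (cone). Eliminating
  \<open>D\<close> at its stationary point \<open>D\<^sub>i\<^sub>j = M\<^sub>i\<^sub>j exp (x\<^sub>j - \<beta>\<^sub>i - 1)\<close> turns the Lagrangian bound
  into feasibility of \<open>(x, \<beta>, \<zeta>)\<close> with objective at most the supremum.\<close>

section \<open>Entropy lower bound for the capacity\<close>

text \<open>Minus the relative entropy of \<open>D\<close> with respect to \<open>M\<close>, without
  normalization of either matrix.\<close>

definition matrix_entropy :: "real^'n^'m \<Rightarrow> real^'n^'m \<Rightarrow> real" where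
  "matrix_entropy M D = (\<Sum>i\<in>UNIV. \<Sum>j\<in>UNIV. D $ i $ j * ln (M $ i $ j / D $ i $ j))"

text \<open>The right side, linear in \<open>(a, b)\<close>, is the tangent plane at
  \<open>(c, d)\<close> of the homogeneous function \<open>b * ln (a / b)\<close>. The inequality is
  \<open>ln z \<le> z - 1\<close> at \<open>z = (a * d) / (b * c)\<close>.\<close>

lemma mult_ln_ratio_le:
  fixes a b c d :: real
  assumes "0 < a" "0 < b" "0 < c" "0 < d"
  shows "b * ln (a / b) \<le> b * ln (c / d) + a * (d / c) - b"
proof -
  have "ln (a / b) - ln (c / d) = ln ((a * d) / (b * c))"
    using assms by (simp add: ln_div ln_mult)
  also have "\<dots> \<le> (a * d) / (b * c) - 1"
    using assms by (intro ln_le_minus_one) simp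
  finally have "b * (ln (a / b) - ln (c / d)) \<le> b * ((a * d) / (b * c) - 1)"
    using assms by (intro mult_left_mono) auto
  also have "\<dots> = a * (d / c) - b"
    using assms by (simp add: field_simps)
  finally show ?thesis
    by (simp add: right_diff_distrib)
qed

text \<open>Both points lie below the tangent plane at their convex combination
  \<open>(p, q)\<close>. Averaging the two bounds gives the value of that plane at
  \<open>(p, q)\<close>, where it touches the function.\<close>

lemma mult_ln_ratio_concave:
  fixes a b c d u v :: real
  assumes "0 < a" "0 < b" "0 < c" "0 < d" "0 \<le> u" "0 \<le> v" "u + v = 1"
  shows "u * (b * ln (a / b)) + v * (d * ln (c / d))
         \<le> (u * b + v * d) * ln ((u * a + v * c) / (u * b + v * d))"
proof -
  define p q where "p = u * a + v * c" and "q = u * b + v * d"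
  have pos: "0 < p" "0 < q"
    unfolding p_def q_def using assms
    by (metis add_nonneg_pos add_pos_nonneg less_eq_real_def mult_nonneg_nonneg mult_pos_pos
        zero_neq_one add_0_right)+
  have eq: "u * (b * l + a * r - b) + v * (d * l + c * r - d) = q * l + p * r - q" for l r
    by (simp add: p_def q_def algebra_simps)
  have "u * (b * ln (a / b)) + v * (d * ln (c / d))
        \<le> u * (b * ln (p / q) + a * (q / p) - b) + v * (d * ln (p / q) + c * (q / p) - d)"
    using assms pos by (intro add_mono mult_left_mono mult_ln_ratio_le) auto
  also have "\<dots> = q * ln (p / q) + p * (q / p) - q"
    by (rule eq)
  also have "\<dots> = q * ln (p / q)"
    using pos by simp
  finally show ?thesis
    by (simp add: p_def q_def)
qed

lemma matrix_entropy_concave: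
  fixes M D M' D' :: "real^'n^'m"
  assumes "\<And>i j. 0 < M $ i $ j" "\<And>i j. 0 < D $ i $ j"
    and "\<And>i j. 0 < M' $ i $ j" "\<And>i j. 0 < D' $ i $ j"
    and "0 \<le> u" "0 \<le> v" "u + v = 1"
  shows "u * matrix_entropy M D + v * matrix_entropy M' D'
         \<le> matrix_entropy (u *\<^sub>R M + v *\<^sub>R M') (u *\<^sub>R D + v *\<^sub>R D')"
proof -
  have "u * matrix_entropy M D + v * matrix_entropy M' D' =
     (\<Sum>i\<in>UNIV. \<Sum>j\<in>UNIV. u * (D $ i $ j * ln (M $ i $ j / D $ i $ j))
        + v * (D' $ i $ j * ln (M' $ i $ j / D' $ i $ j)))"
    by (simp add: matrix_entropy_def sum_distrib_left sum.distrib)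
  also have "\<dots> \<le> matrix_entropy (u *\<^sub>R M + v *\<^sub>R M') (u *\<^sub>R D + v *\<^sub>R D')"
    unfolding matrix_entropy_def using assms
    by (auto intro!: sum_mono mult_ln_ratio_concave)
  finally show ?thesis .
qed

text \<open>Each row of \<open>D\<close> is a probability vector, so Jensen's inequality for
  \<open>ln\<close> bounds the logarithm of each row factor from below. Since the columns also sum
  to \<open>1\<close>, the terms in \<open>ln (y $ j)\<close> add up to the logarithm of the product
  of the \<open>y $ j\<close>, which is \<open>0\<close>.\<close>

lemma exp_matrix_entropy_le_row_product_poly:
  fixes M D :: "real^'n^'n"
  assumes M: "\<And>i j. 0 < M $ i $ j" and D: "\<And>i j. 0 < D $ i $ j"
    and rows: "\<And>i. (\<Sum>j\<in>UNIV. D $ i $ j) = 1" and cols: "\<And>j. (\<Sum>i\<in>UNIV. D $ i $ j) = 1"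
    and y: "\<And>j. 0 \<le> y $ j" "(\<Prod>j\<in>UNIV. y $ j) = 1"
  shows "exp (matrix_entropy M D) \<le> row_product_poly M y"
proof -
  define a where "a i = (\<Sum>j\<in>UNIV. M $ i $ j * y $ j)" for i
  have ypos: "0 < y $ j" for j
    using y(1)[of j] y(2) by (metis UNIV_I finite less_eq_real_def prod_zero_iff zero_neq_one)
  have apos: "0 < a i" for i
    unfolding a_def using M ypos by (intro sum_pos) auto
  have "(\<Sum>j\<in>UNIV. D $ i $ j * ln (M $ i $ j / D $ i $ j)) + (\<Sum>j\<in>UNIV. D $ i $ j * ln (y $ j))
        \<le> ln (a i)" for i
  proof -
    have "(\<Sum>j\<in>UNIV. D $ i $ j * ln (M $ i $ j / D $ i $ j)) + (\<Sum>j\<in>UNIV. D $ i $ j * ln (y $ j))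
        = (\<Sum>j\<in>UNIV. D $ i $ j * ln (M $ i $ j * y $ j / D $ i $ j))"
      using M D ypos
      by (simp add: sum.distrib [symmetric] ln_div ln_mult less_imp_neq [symmetric] algebra_simps)
    \<comment> \<open>Jensen's inequality in tangent form: all entries of the row use the same base
      point \<open>(a i, 1)\<close>, and the correction terms sum to \<open>1 - 1\<close>.\<close>
    also have "\<dots> \<le> (\<Sum>j\<in>UNIV. D $ i $ j * ln (a i / 1) + (M $ i $ j * y $ j) * (1 / a i) - D $ i $ j)"
      using M D ypos apos by (intro sum_mono mult_ln_ratio_le) auto
    also have "\<dots> = ln (a i)"
      using apos[of i] rows[of i]
      by (simp add: sum_subtractf sum.distrib sum_distrib_right [symmetric]
          sum_divide_distrib [symmetric] a_def [symmetric])
    finally show ?thesis .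
  qed
  then have "(\<Sum>i\<in>UNIV. (\<Sum>j\<in>UNIV. D $ i $ j * ln (M $ i $ j / D $ i $ j))
               + (\<Sum>j\<in>UNIV. D $ i $ j * ln (y $ j))) \<le> (\<Sum>i\<in>UNIV. ln (a i))"
    by (intro sum_mono)
  moreover have "(\<Sum>i\<in>UNIV. \<Sum>j\<in>UNIV. D $ i $ j * ln (y $ j)) = 0"
  proof -
    have "(\<Sum>i\<in>UNIV. \<Sum>j\<in>UNIV. D $ i $ j * ln (y $ j)) = (\<Sum>j\<in>UNIV. \<Sum>i\<in>UNIV. D $ i $ j * ln (y $ j))"
      by (rule sum.swap)
    also have "\<dots> = (\<Sum>j\<in>UNIV. ln (y $ j))"
      by (simp add: sum_distrib_right [symmetric] cols)
    also have "\<dots> = ln (\<Prod>j\<in>UNIV. y $ j)"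
      using ypos by (intro ln_prod [symmetric]) (auto simp: less_imp_neq [symmetric])
    finally show ?thesis
      using y by simp
  qed
  ultimately have "matrix_entropy M D \<le> (\<Sum>i\<in>UNIV. ln (a i))"
    by (simp add: matrix_entropy_def sum.distrib)
  then have "exp (matrix_entropy M D) \<le> exp (\<Sum>i\<in>UNIV. ln (a i))"
    by simp
  also have "\<dots> = (\<Prod>i\<in>UNIV. a i)"
    using apos by (simp add: exp_sum)
  finally show ?thesis
    by (simp add: row_product_poly_def a_def)
qed

lemma exp_matrix_entropy_le_capacity:
  fixes M D :: "real^'n^'n"
  assumes "\<And>i j. 0 < M $ i $ j" and "\<And>i j. 0 < D $ i $ j"
    and "\<And>i. (\<Sum>j\<in>UNIV. D $ i $ j) = 1" and "\<And>j. (\<Sum>i\<in>UNIV. D $ i $ j) = 1"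
  shows "ereal (exp (matrix_entropy M D)) \<le> capacity (row_product_poly M)"
  unfolding capacity_def
  by (intro INF_greatest) (use assms in \<open>auto intro!: exp_matrix_entropy_le_row_product_poly\<close>)

section \<open>Slopes and intercepts of bounded affine functions\<close>

lemma affine_bounded_imp_slope_nonpos:
  fixes a b c :: real
  assumes "\<And>s. 0 \<le> s \<Longrightarrow> a * s + b \<le> c"
  shows "a \<le> 0"
proof (rule ccontr)
  assume "\<not> a \<le> 0"
  \<comment> \<open>At this point the affine function is at least \<open>c + 1\<close>.\<close>
  with assms[of "(\<bar>c\<bar> + \<bar>b\<bar> + 1) / a"] show False
    by simp
qed

lemma affine_bounded_imp_slope_zero:
  fixes a b c :: real
  assumes "\<And>s. a * s + b \<le> c"
  shows "a = 0"
  using affine_bounded_imp_slope_nonpos[of a b c] affine_bounded_imp_slope_nonpos[of "- a" b c]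
    assms assms[of "- _"] by fastforce

lemma affine_bounded_imp_intercept_le:
  fixes a b c :: real
  assumes "\<And>e. 0 < e \<Longrightarrow> a * e + b \<le> c"
  shows "b \<le> c"
proof -
  have "((\<lambda>e. a * e + b) \<longlongrightarrow> a * 0 + b) (at_right 0)"
    by (intro tendsto_intros)
  moreover have "\<forall>\<^sub>F e in at_right 0. a * e + b \<le> c"
    using assms by (simp add: eventually_at_right_less eventually_at_filter)
  ultimately show ?thesis
    using tendsto_upperbound trivial_limit_at_right_real by force
qed

section \<open>Weak duality\<close>

lemma inner_adjoint_entries:
  fixes L :: "real^'n^'m \<Rightarrow> 'a::euclidean_space"
  assumes "linear L"
  shows "L M \<bullet> \<zeta> = (\<Sum>i\<in>UNIV. \<Sum>j\<in>UNIV. M $ i $ j * adjoint L \<zeta> $ i $ j)"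
  using adjoint_works[OF assms, of M \<zeta>] by (simp add: inner_vec_def)

text \<open>The row factors are decoupled by \<open>u \<le> exp (u - 1)\<close>, which turns their
  product into a sum in the exponent. The exponential constraints bound that sum by
  \<open>- (L M \<bullet> \<zeta>)\<close>, and pairing \<open>\<zeta>\<close> with
  \<open>g + L M\<close> finishes.\<close>

lemma row_product_poly_exp_le:
  fixes M :: "real^'n^'n" and L :: "real^'n^'n \<Rightarrow> real^'l"
  assumes "linear L" and M: "\<And>i j. 0 \<le> M $ i $ j" and mem: "g + L M \<in> K"
    and feas: "(x, \<beta>, \<zeta>) \<in> capacity_cgp_feasible L K"
  shows "row_product_poly M (\<chi> j. exp (x $ j)) \<le> exp (g \<bullet> \<zeta> + 1 \<bullet> \<beta>)"
proof -
  define u where "u i = (\<Sum>j\<in>UNIV. M $ i $ j * exp (x $ j - \<beta> $ i - 1))" for i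
  have "(\<Sum>j\<in>UNIV. M $ i $ j * exp (x $ j)) \<le> exp (u i + \<beta> $ i)" for i
  proof -
    have "(\<Sum>j\<in>UNIV. M $ i $ j * exp (x $ j)) = u i * exp (\<beta> $ i + 1)"
      by (simp add: u_def sum_distrib_right mult.assoc exp_add [symmetric])
    also have "\<dots> \<le> exp (u i - 1) * exp (\<beta> $ i + 1)"
      using exp_ge_add_one_self[of "u i - 1"] by (intro mult_right_mono) auto
    also have "\<dots> = exp (u i + \<beta> $ i)"
      by (simp add: exp_add [symmetric])
    finally show ?thesis .
  qed
  then have "row_product_poly M (\<chi> j. exp (x $ j)) \<le> (\<Prod>i\<in>UNIV. exp (u i + \<beta> $ i))"
    unfolding row_product_poly_def using M by (intro prod_mono) (auto intro!: sum_nonneg)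
  also have "\<dots> = exp ((\<Sum>i\<in>UNIV. u i) + 1 \<bullet> \<beta>)"
    by (simp add: exp_sum [symmetric] sum.distrib inner_vec_def)
  also have "\<dots> \<le> exp (g \<bullet> \<zeta> + 1 \<bullet> \<beta>)"
  proof -
    have "exp (x $ j - \<beta> $ i - 1) \<le> - adjoint L \<zeta> $ i $ j" for i j
    proof -
      have "adjoint L \<zeta> $ i $ j + exp (x $ j - \<beta> $ i - 1) \<le> 0"
        using feas by (simp add: capacity_cgp_feasible_def)
      then show ?thesis
        by simp
    qed
    then have "(\<Sum>i\<in>UNIV. u i) \<le> (\<Sum>i\<in>UNIV. \<Sum>j\<in>UNIV. M $ i $ j * (- adjoint L \<zeta> $ i $ j))"
      unfolding u_def using M by (intro sum_mono mult_left_mono)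
    also have "\<dots> = - (L M \<bullet> \<zeta>)"
      by (simp add: inner_adjoint_entries[OF \<open>linear L\<close>] sum_negf)
    also have "\<dots> \<le> g \<bullet> \<zeta>"
      using feas mem by (auto simp: capacity_cgp_feasible_def dual_cone_def inner_add_left)
    finally show ?thesis
      by simp
  qed
  finally show ?thesis .
qed

text \<open>The constraint \<open>1 \<bullet> x = 0\<close> says that the vector with entries
  \<open>exp (x $ j)\<close> has product \<open>1\<close>, so it competes in the infimum defining
  the capacity.\<close>

lemma capacity_le_cgp_value:
  fixes M :: "real^'n^'n" and L :: "real^'n^'n \<Rightarrow> real^'l"
  assumes "linear L" "\<And>i j. 0 \<le> M $ i $ j" "g + L M \<in> K"
    and feas: "(x, \<beta>, \<zeta>) \<in> capacity_cgp_feasible L K"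
  shows "capacity (row_product_poly M) \<le> ereal (exp (g \<bullet> \<zeta> + 1 \<bullet> \<beta>))"
proof -
  have "(\<Prod>j\<in>UNIV. exp (x $ j)) = 1"
    using feas by (simp add: capacity_cgp_feasible_def inner_vec_def exp_sum [symmetric])
  then show ?thesis
    unfolding capacity_def
    by (intro INF_lower2[where i = "\<chi> j. exp (x $ j)"])
      (auto intro: row_product_poly_exp_le[OF assms])
qed

section \<open>Lagrange multipliers from a separating hyperplane\<close>

text \<open>The column sums are only required to be equal to each other, through the free parameter \<open>s\<close>:
  once the row sums are \<open>1\<close> this forces \<open>s = 1\<close>. Requiring them to be \<open>1\<close> would make the
  constraints linearly dependent and the separating hyperplane possibly degenerate.\<close>

definition perturbed_values ::
  "(real^'n^'n \<Rightarrow> real^'l) \<Rightarrow> real^'l \<Rightarrow> (real^'l) set \<Rightarrow>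
    (real \<times> (real^'n) \<times> (real^'n) \<times> (real^'l)) set" where
  "perturbed_values L g K =
     {(t, r, c, w). \<exists>M D s k. (\<forall>i j. 0 < M $ i $ j) \<and> (\<forall>i j. 0 < D $ i $ j) \<and> k \<in> K \<and>
        t \<le> matrix_entropy M D \<and> r = (\<chi> i. (\<Sum>j\<in>UNIV. D $ i $ j) - 1) \<and>
        c = (\<chi> j. (\<Sum>i\<in>UNIV. D $ i $ j) - s) \<and> w = g + L M - k}"

lemma perturbed_valuesI:
  assumes "\<And>i j. 0 < M $ i $ j" "\<And>i j. 0 < D $ i $ j" "k \<in> K" "t \<le> matrix_entropy M D"
  shows "(t, \<chi> i. (\<Sum>j\<in>UNIV. D $ i $ j) - 1, \<chi> j. (\<Sum>i\<in>UNIV. D $ i $ j) - s, g + L M - k)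
    \<in> perturbed_values L g K"
  using assms unfolding perturbed_values_def by blast

text \<open>The bound on \<open>t\<close> describes a hypograph of the jointly concave entropy; the
  other components are affine in \<open>(M, D, s, k)\<close>, and \<open>k\<close> ranges over a
  convex set.\<close>

lemma convex_perturbed_values:
  assumes "linear L" "convex K"
  shows "convex (perturbed_values L g K)"
proof (rule convexI)
  fix z z' and u v :: real
  assume z: "z \<in> perturbed_values L g K" and z': "z' \<in> perturbed_values L g K"
    and uv: "0 \<le> u" "0 \<le> v" "u + v = 1"
  obtain t M D s k where 1: "\<And>i j. 0 < M $ i $ j" "\<And>i j. 0 < D $ i $ j" "k \<in> K"
    "t \<le> matrix_entropy M D"
    and zeq: "z = (t, \<chi> i. (\<Sum>j\<in>UNIV. D $ i $ j) - 1, \<chi> j. (\<Sum>i\<in>UNIV. D $ i $ j) - s, g + L M - k)"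
    using z unfolding perturbed_values_def by blast
  obtain t' M' D' s' k' where 2: "\<And>i j. 0 < M' $ i $ j" "\<And>i j. 0 < D' $ i $ j" "k' \<in> K"
    "t' \<le> matrix_entropy M' D'"
    and zeq': "z' = (t', \<chi> i. (\<Sum>j\<in>UNIV. D' $ i $ j) - 1, \<chi> j. (\<Sum>i\<in>UNIV. D' $ i $ j) - s', g + L M' - k')"
    using z' unfolding perturbed_values_def by blast
  have pos: "0 < u * a + v * b" if "0 < a" "0 < b" for a b :: real
    using uv that by (metis add_nonneg_pos add_pos_nonneg less_eq_real_def mult_nonneg_nonneg
        mult_pos_pos zero_neq_one add_0_right)
  have 3: "u * t + v * t' \<le> matrix_entropy (u *\<^sub>R M + v *\<^sub>R M') (u *\<^sub>R D + v *\<^sub>R D')"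
    using matrix_entropy_concave[OF 1(1,2) 2(1,2) uv] 1(4) 2(4) uv
    by (smt (verit) mult_left_mono)
  have rows: "u * (a - 1) + v * (b - 1) = u * a + v * b - 1" for a b :: real
  proof -
    have "u * (a - 1) + v * (b - 1) = u * a + v * b - (u + v)"
      by (simp add: algebra_simps)
    then show ?thesis
      by (simp add: uv)
  qed
  have cols: "u * (a - s) + v * (b - s') = u * a + v * b - (u * s + v * s')" for a b :: real
    by (simp add: algebra_simps)
  have g: "u *\<^sub>R g + v *\<^sub>R g = g"
    using uv by (simp flip: scaleR_left_distrib)
  have cone: "u *\<^sub>R (g + L M - k) + v *\<^sub>R (g + L M' - k')
      = g + L (u *\<^sub>R M + v *\<^sub>R M') - (u *\<^sub>R k + v *\<^sub>R k')"
  proof -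
    have "u *\<^sub>R (g + L M - k) + v *\<^sub>R (g + L M' - k')
        = (u *\<^sub>R g + v *\<^sub>R g) + (u *\<^sub>R L M + v *\<^sub>R L M') - (u *\<^sub>R k + v *\<^sub>R k')"
      by (simp add: scaleR_right_distrib scaleR_right_diff_distrib)
    then show ?thesis
      by (simp add: g linear_add[OF \<open>linear L\<close>] linear_cmul[OF \<open>linear L\<close>])
  qed
  have "u *\<^sub>R z + v *\<^sub>R z' = (u * t + v * t',
      \<chi> i. (\<Sum>j\<in>UNIV. (u *\<^sub>R D + v *\<^sub>R D') $ i $ j) - 1,
      \<chi> j. (\<Sum>i\<in>UNIV. (u *\<^sub>R D + v *\<^sub>R D') $ i $ j) - (u * s + v * s'),
      g + L (u *\<^sub>R M + v *\<^sub>R M') - (u *\<^sub>R k + v *\<^sub>R k'))"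
    unfolding zeq zeq'
    by (simp add: cone vec_eq_iff sum.distrib sum_distrib_left [symmetric] rows cols
        del: scaleR_right_diff_distrib)
  moreover have "u *\<^sub>R k + v *\<^sub>R k' \<in> K"
    using \<open>convex K\<close> 1(3) 2(3) uv by (auto intro: convexD)
  ultimately show "u *\<^sub>R z + v *\<^sub>R z' \<in> perturbed_values L g K"
    using perturbed_valuesI[of "u *\<^sub>R M + v *\<^sub>R M'" "u *\<^sub>R D + v *\<^sub>R D'" "u *\<^sub>R k + v *\<^sub>R k'" K
        "u * t + v * t'" "u * s + v * s'" g L] 1 2 3 pos
    by simp
qed

text \<open>The multipliers paired with the residuals of the row, column and conic constraints. The
  terms are collected by entries of \<open>D\<close> because \<open>D\<close> is later chosen entry
  by entry.\<close>

definition lagrangian_constraint_part ::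
  "(real^'n^'n \<Rightarrow> real^'l) \<Rightarrow> real^'l \<Rightarrow> real^'n \<Rightarrow> real^'n \<Rightarrow> real^'l \<Rightarrow>
    real^'n^'n \<Rightarrow> real^'n^'n \<Rightarrow> real \<Rightarrow> real^'l \<Rightarrow> real" where
  "lagrangian_constraint_part L g \<beta> x \<zeta> M D s k =
     (\<Sum>i\<in>UNIV. \<Sum>j\<in>UNIV. (\<beta> $ i + x $ j) * D $ i $ j) - 1 \<bullet> \<beta> - s * (1 \<bullet> x)
     + \<zeta> \<bullet> (g + L M - k)"

lemma lagrangian_constraint_part_eq_inner:
  "lagrangian_constraint_part L g \<beta> x \<zeta> M D s k =
     \<beta> \<bullet> (\<chi> i. (\<Sum>j\<in>UNIV. D $ i $ j) - 1) + x \<bullet> (\<chi> j. (\<Sum>i\<in>UNIV. D $ i $ j) - s)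
     + \<zeta> \<bullet> (g + L M - k)"
proof -
  have "(\<Sum>i\<in>UNIV. \<Sum>j\<in>UNIV. D $ i $ j * x $ j) = (\<Sum>j\<in>UNIV. \<Sum>i\<in>UNIV. D $ i $ j * x $ j)"
    by (rule sum.swap)
  then show ?thesis
    by (simp add: lagrangian_constraint_part_def inner_vec_def [where 'b = 'a]
        inner_vec_def [where 'a = real] distrib_left right_diff_distrib
        sum.distrib sum_subtractf sum_distrib_left mult.commute)
qed

text \<open>A common point of \<open>?S\<close> and \<open>?T\<close> would be a feasible pair with
  entropy above \<open>v\<close>. The normal of a hyperplane separating the two sets supplies the
  multipliers, with \<open>\<tau>\<close> possibly \<open>0\<close> at this stage.\<close>

lemma separating_multipliers:
  fixes L :: "real^'n^'n \<Rightarrow> real^'l"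
  assumes "linear L" and K: "convex K" "K \<noteq> {}"
    and bound: "\<And>M D. \<lbrakk>\<And>i j. 0 < M $ i $ j; \<And>i j. 0 < D $ i $ j; g + L M \<in> K;
        \<And>i. (\<Sum>j\<in>UNIV. D $ i $ j) = 1; \<And>j. (\<Sum>i\<in>UNIV. D $ i $ j) = 1\<rbrakk>
        \<Longrightarrow> matrix_entropy M D \<le> v"
  obtains \<tau> \<beta> x \<zeta> where "0 \<le> \<tau>" "(\<tau>, \<beta>, x, \<zeta>) \<noteq> 0"
    "\<And>M D s k. \<lbrakk>\<And>i j. 0 < M $ i $ j; \<And>i j. 0 < D $ i $ j; k \<in> K\<rbrakk> \<Longrightarrow>
      \<tau> * matrix_entropy M D + lagrangian_constraint_part L g \<beta> x \<zeta> M D s k \<le> \<tau> * v"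
proof -
  let ?S = "perturbed_values L g K"
  let ?T = "{v<..} \<times> {0 :: (real^'n) \<times> (real^'n) \<times> (real^'l)}"
  obtain k0 where k0: "k0 \<in> K"
    using K by blast
  have "?S \<noteq> {}"
    using perturbed_valuesI[OF _ _ k0 order_refl, of "\<chi> i j. 1" "\<chi> i j. 1"] by fastforce
  moreover have "?T \<noteq> {}"
    by (auto intro: exI[of _ "v + 1"])
  moreover have "?S \<inter> ?T = {}"
  proof (rule ccontr)
    assume "?S \<inter> ?T \<noteq> {}"
    then obtain t where t: "v < t" "(t, 0, 0, 0) \<in> ?S"
      by (auto simp: zero_prod_def)
    then obtain M D s k where *: "\<And>i j. 0 < M $ i $ j" "\<And>i j. 0 < D $ i $ j" "k \<in> K"
      "t \<le> matrix_entropy M D" "0 = (\<chi> i. (\<Sum>j\<in>UNIV. D $ i $ j) - 1)"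
      "0 = (\<chi> j. (\<Sum>i\<in>UNIV. D $ i $ j) - s)" "0 = g + L M - k"
      unfolding perturbed_values_def by blast
    have r: "(\<Sum>j\<in>UNIV. D $ i $ j) = 1" for i
      using *(5) by (simp add: vec_eq_iff)
    have c: "(\<Sum>i\<in>UNIV. D $ i $ j) = s" for j
      using *(6) by (simp add: vec_eq_iff)
    \<comment> \<open>Counting the total mass of \<open>D\<close> by rows and by columns identifies
      the common column sum.\<close>
    have "(\<Sum>i\<in>UNIV. \<Sum>j\<in>UNIV. D $ i $ j) = (\<Sum>j\<in>UNIV. \<Sum>i\<in>UNIV. D $ i $ j)"
      by (rule sum.swap)
    then have "s = 1"
      by (simp add: r c)
    then have "matrix_entropy M D \<le> v"
      using * r c by (intro bound) auto
    with * t show False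
      by simp
  qed
  moreover have "convex ?S" "convex ?T"
    using convex_perturbed_values[OF \<open>linear L\<close> K(1)] by (auto intro!: convex_Times)
  ultimately obtain a b where a: "a \<noteq> 0" "\<forall>z\<in>?S. a \<bullet> z \<le> b" "\<forall>z\<in>?T. b \<le> a \<bullet> z"
    using separating_hyperplane_sets by metis
  obtain \<tau> \<beta> x \<zeta> where a_eq: "a = (\<tau>, \<beta>, x, \<zeta>)"
    by (metis surj_pair)
  have T: "b \<le> \<tau> * t" if "v < t" for t
    using a(3)[rule_format, of "(t, 0)"] that by (simp add: a_eq)
  \<comment> \<open>Let \<open>t\<close> decrease to \<open>v\<close>, which itself is excluded from
    the ray.\<close>
  have "b \<le> \<tau> * v"
    using affine_bounded_imp_intercept_le[of "- \<tau>" "b - \<tau> * v" 0] T[of "v + _"]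
    by (simp add: algebra_simps)
  \<comment> \<open>Let \<open>t\<close> grow. The base point is \<open>v + 1\<close> because the
    slope lemma includes the parameter \<open>0\<close>.\<close>
  moreover have "0 \<le> \<tau>"
    using affine_bounded_imp_slope_nonpos[of "- \<tau>" "b - \<tau> * (v + 1)" 0] T[of "v + 1 + _"]
    by (simp add: algebra_simps)
  moreover have "\<tau> * matrix_entropy M D + lagrangian_constraint_part L g \<beta> x \<zeta> M D s k \<le> b"
    if "\<And>i j. 0 < M $ i $ j" "\<And>i j. 0 < D $ i $ j" "k \<in> K" for M D s k
    using a(2)[rule_format, OF perturbed_valuesI[OF that order_refl, where s = s]]
    by (simp add: a_eq lagrangian_constraint_part_eq_inner)
  ultimately show ?thesis
    using that[of \<tau> \<beta> x \<zeta>] a(1) a_eq by (meson order_trans)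
qed

text \<open>If \<open>\<tau>\<close> were \<open>0\<close>, testing the separation inequality near
  the Slater point would force all multipliers to vanish. Hence \<open>\<tau>\<close> is positive
  and can be divided out.\<close>

lemma slater_multipliers:
  fixes L :: "real^'n^'n \<Rightarrow> real^'l"
  assumes "linear L" and K: "convex K"
    and slater: "\<And>i j. 0 < M0 $ i $ j" "g + L M0 \<in> interior K"
    and bound: "\<And>M D. \<lbrakk>\<And>i j. 0 < M $ i $ j; \<And>i j. 0 < D $ i $ j; g + L M \<in> K;
        \<And>i. (\<Sum>j\<in>UNIV. D $ i $ j) = 1; \<And>j. (\<Sum>i\<in>UNIV. D $ i $ j) = 1\<rbrakk>
        \<Longrightarrow> matrix_entropy M D \<le> v"
  obtains \<beta> x \<zeta> where
    "\<And>M D s k. \<lbrakk>\<And>i j. 0 < M $ i $ j; \<And>i j. 0 < D $ i $ j; k \<in> K\<rbrakk> \<Longrightarrow>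
      matrix_entropy M D + lagrangian_constraint_part L g \<beta> x \<zeta> M D s k \<le> v"
proof -
  have "K \<noteq> {}"
    using slater(2) interior_subset by auto
  obtain \<tau> \<beta> x \<zeta> where \<tau>: "0 \<le> \<tau>" "(\<tau>, \<beta>, x, \<zeta>) \<noteq> 0"
    and sep: "\<And>M D s k. \<lbrakk>\<And>i j. 0 < M $ i $ j; \<And>i j. 0 < D $ i $ j; k \<in> K\<rbrakk> \<Longrightarrow>
      \<tau> * matrix_entropy M D + lagrangian_constraint_part L g \<beta> x \<zeta> M D s k \<le> \<tau> * v"
  proof (rule separating_multipliers[OF \<open>linear L\<close> K \<open>K \<noteq> {}\<close>])
    fix M D :: "real^'n^'n"
    assume "\<And>i j. 0 < M $ i $ j" "\<And>i j. 0 < D $ i $ j" "g + L M \<in> K"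
      "\<And>i. (\<Sum>j\<in>UNIV. D $ i $ j) = 1" "\<And>j. (\<Sum>i\<in>UNIV. D $ i $ j) = 1"
    then show "matrix_entropy M D \<le> v"
      by (rule bound)
  next
    fix \<tau> \<beta> x \<zeta>
    assume "0 \<le> \<tau>" "(\<tau>, \<beta>, x, \<zeta>) \<noteq> 0"
      "\<And>M D s k. \<lbrakk>\<And>i j. 0 < M $ i $ j; \<And>i j. 0 < D $ i $ j; k \<in> K\<rbrakk> \<Longrightarrow>
        \<tau> * matrix_entropy M D + lagrangian_constraint_part L g \<beta> x \<zeta> M D s k \<le> \<tau> * v"
    then show thesis
      by (rule that)
  qed
  have "\<tau> \<noteq> 0"
  proof
    assume "\<tau> = 0"
    then have nonpos: "lagrangian_constraint_part L g \<beta> x \<zeta> M0 D s k \<le> 0"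
      if "\<And>i j. 0 < D $ i $ j" "k \<in> K" for D s k
      using sep[of M0 D k s] slater that by simp
    obtain e where e: "0 < e" "cball (g + L M0) e \<subseteq> K"
      using slater(2) mem_interior_cball by blast
    define n where "n = real CARD('n)"
    have n: "0 < n"
      by (simp add: n_def)
    \<comment> \<open>The uniform doubly stochastic matrix has zero row and column residuals, so
      only the cone term survives.\<close>
    define U :: "real^'n^'n" where "U = (\<chi> i j. 1 / n)"
    have U: "lagrangian_constraint_part L g \<beta> x \<zeta> M0 U 1 k = \<zeta> \<bullet> (g + L M0 - k)" for k
      using n by (simp add: lagrangian_constraint_part_eq_inner U_def n_def flip: zero_vec_def)
    have "\<zeta> = 0"
    proof (rule ccontr)
      assume "\<zeta> \<noteq> 0"
      \<comment> \<open>Moving from the interior point against \<open>\<zeta>\<close> by distance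
        \<open>e\<close> stays in \<open>K\<close> and makes the cone term
        \<open>e * norm \<zeta>\<close>.\<close>
      define k where "k = g + L M0 - (e / norm \<zeta>) *\<^sub>R \<zeta>"
      have "k \<in> K"
        using e \<open>\<zeta> \<noteq> 0\<close> by (intro subsetD[OF e(2)]) (simp add: k_def dist_norm)
      then have "\<zeta> \<bullet> (g + L M0 - k) \<le> 0"
        using nonpos[of U k 1] U n by (simp add: U_def)
      moreover have "0 < e * (\<zeta> \<bullet> \<zeta>) / norm \<zeta>"
        using e \<open>\<zeta> \<noteq> 0\<close> by simp
      ultimately show False
        by (simp add: k_def)
    qed
    have k: "g + L M0 \<in> K"
      using e by (intro subsetD[OF e(2)]) simp
    \<comment> \<open>The parameter \<open>s\<close> is free in sign, so its coefficient vanishes;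
      \<open>M0\<close> serves as an arbitrary positive \<open>D\<close>.\<close>
    have "- (1 \<bullet> x) * s + lagrangian_constraint_part L g \<beta> x \<zeta> M0 M0 0 (g + L M0) \<le> 0" for s
      using nonpos[of M0 "g + L M0" s] k slater(1) by (simp add: lagrangian_constraint_part_def mult.commute[of s])
    then have "- (1 \<bullet> x) = 0"
      by (rule affine_bounded_imp_slope_zero)
    then have x: "1 \<bullet> x = 0"
      by simp
    define m where "m = Max (range (\<lambda>(i, j). \<bar>\<beta> $ i + x $ j\<bar>)) + 1"
    have m: "\<bar>\<beta> $ i + x $ j\<bar> < m" for i j
    proof -
      have "\<bar>\<beta> $ i + x $ j\<bar> \<le> Max (range (\<lambda>(i, j). \<bar>\<beta> $ i + x $ j\<bar>))"
        by (intro Max_ge) auto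
      then show ?thesis
        by (simp add: m_def)
    qed
    have "0 < m"
      using m[of undefined undefined] by linarith
    \<comment> \<open>Perturbing \<open>U\<close> along the gradient
      \<open>\<beta> $ i + x $ j\<close> raises the Lagrangian by a sum of squares; \<open>m\<close>
      is large enough to keep all entries positive.\<close>
    define D where "D = (\<chi> i j. 1 / n + (\<beta> $ i + x $ j) / (n * m))"
    have "0 < D $ i $ j" for i j
    proof -
      have "0 < (m + (\<beta> $ i + x $ j)) / (n * m)"
        using m[of i j] \<open>0 < m\<close> n by (intro divide_pos_pos) auto
      then show ?thesis
        using \<open>0 < m\<close> n by (simp add: D_def add_divide_distrib)
    qed
    then have "lagrangian_constraint_part L g \<beta> x \<zeta> M0 D 1 (g + L M0) \<le> 0"
      using k by (intro nonpos)
    moreover have "lagrangian_constraint_part L g \<beta> x \<zeta> M0 D 1 (g + L M0) =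
        lagrangian_constraint_part L g \<beta> x \<zeta> M0 U 1 (g + L M0)
        + (\<Sum>i\<in>UNIV. \<Sum>j\<in>UNIV. (\<beta> $ i + x $ j)\<^sup>2) / (n * m)"
    proof -
      have "(\<beta> $ i + x $ j) * D $ i $ j
          = (\<beta> $ i + x $ j) * U $ i $ j + (\<beta> $ i + x $ j)\<^sup>2 / (n * m)" for i j
        by (simp add: D_def U_def distrib_left[of "_ + _"] power2_eq_square)
      then show ?thesis
        by (simp add: lagrangian_constraint_part_def sum.distrib sum_divide_distrib)
    qed
    ultimately have "(\<Sum>i\<in>UNIV. \<Sum>j\<in>UNIV. (\<beta> $ i + x $ j)\<^sup>2) / (n * m) \<le> 0"
      by (simp add: U)
    then have "(\<Sum>i\<in>UNIV. \<Sum>j\<in>UNIV. (\<beta> $ i + x $ j)\<^sup>2) \<le> 0"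
      using mult_pos_pos[OF n \<open>0 < m\<close>] by (simp add: divide_le_0_iff)
    then have "(\<Sum>i\<in>UNIV. \<Sum>j\<in>UNIV. (\<beta> $ i + x $ j)\<^sup>2) = 0"
      by (intro antisym sum_nonneg) auto
    then have zero: "\<beta> $ i + x $ j = 0" for i j
      by (simp add: sum_nonneg_eq_0_iff sum_nonneg)
    \<comment> \<open>The sums \<open>\<beta> $ i + x $ j\<close> determine \<open>x\<close> only up
      to a constant shift, which \<open>1 \<bullet> x = 0\<close> removes.\<close>
    have "x $ j = 0" for j
    proof -
      have "x $ k = x $ j" for k
        using zero[of undefined k] zero[of undefined j] by simp
      then have "(\<Sum>k\<in>UNIV. x $ k) = (\<Sum>k\<in>(UNIV :: 'n set). x $ j)"
        by (intro sum.cong) auto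
      then have "1 \<bullet> x = n * x $ j"
        by (simp add: inner_vec_def n_def)
      with x n show ?thesis
        by simp
    qed
    moreover from this zero have "\<beta> $ i = 0" for i
      by (metis add.right_neutral)
    ultimately have "(\<tau>, \<beta>, x, \<zeta>) = 0"
      using \<open>\<tau> = 0\<close> \<open>\<zeta> = 0\<close> by (simp add: zero_prod_def vec_eq_iff)
    with \<tau> show False
      by simp
  qed
  with \<tau> have "0 < \<tau>"
    by simp
  show ?thesis
  proof
    fix M D :: "real^'n^'n" and s k
    assume *: "\<And>i j. 0 < M $ i $ j" "\<And>i j. 0 < D $ i $ j" "k \<in> K"
    have "\<tau> * (matrix_entropy M D
        + lagrangian_constraint_part L g (\<beta> /\<^sub>R \<tau>) (x /\<^sub>R \<tau>) (\<zeta> /\<^sub>R \<tau>) M D s k)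
      = \<tau> * matrix_entropy M D + lagrangian_constraint_part L g \<beta> x \<zeta> M D s k"
      using \<open>0 < \<tau>\<close>
      by (simp add: lagrangian_constraint_part_eq_inner distrib_left mult.assoc [symmetric])
    also have "\<dots> \<le> \<tau> * v"
      using * by (rule sep)
    finally show "matrix_entropy M D
        + lagrangian_constraint_part L g (\<beta> /\<^sub>R \<tau>) (x /\<^sub>R \<tau>) (\<zeta> /\<^sub>R \<tau>) M D s k \<le> v"
      using \<open>0 < \<tau>\<close> by simp
  qed
qed

section \<open>Strong duality: a feasible point from the multipliers\<close>

text \<open>Each constraint of the program is read off from one Lagrangian bound: the free
  \<open>s\<close> gives \<open>1 \<bullet> x = 0\<close>, scaling \<open>k\<close> along rays of
  \<open>K\<close> gives the dual cone, and optimizing over \<open>D\<close> gives the exponential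
  constraints. The multiplier \<open>\<beta>\<close> enters the program with opposite sign.\<close>

lemma capacity_cgp_dual_point:
  fixes L :: "real^'n^'n \<Rightarrow> real^'l"
  assumes "linear L" and K: "convex_cone K"
    and slater: "\<And>i j. 0 < M0 $ i $ j" "g + L M0 \<in> interior K"
    and bound: "\<And>M D. \<lbrakk>\<And>i j. 0 < M $ i $ j; \<And>i j. 0 < D $ i $ j; g + L M \<in> K;
        \<And>i. (\<Sum>j\<in>UNIV. D $ i $ j) = 1; \<And>j. (\<Sum>i\<in>UNIV. D $ i $ j) = 1\<rbrakk>
        \<Longrightarrow> matrix_entropy M D \<le> v"
  obtains x \<beta> \<zeta> where "(x, \<beta>, \<zeta>) \<in> capacity_cgp_feasible L K" "g \<bullet> \<zeta> + 1 \<bullet> \<beta> \<le> v"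
proof -
  have "convex K"
    using K by (simp add: convex_cone_def)
  obtain \<beta> x \<zeta> where sep:
    "\<And>M D s k. \<lbrakk>\<And>i j. 0 < M $ i $ j; \<And>i j. 0 < D $ i $ j; k \<in> K\<rbrakk> \<Longrightarrow>
      matrix_entropy M D + lagrangian_constraint_part L g \<beta> x \<zeta> M D s k \<le> v"
  proof (rule slater_multipliers[OF \<open>linear L\<close> \<open>convex K\<close> slater])
    fix M D :: "real^'n^'n"
    assume "\<And>i j. 0 < M $ i $ j" "\<And>i j. 0 < D $ i $ j" "g + L M \<in> K"
      "\<And>i. (\<Sum>j\<in>UNIV. D $ i $ j) = 1" "\<And>j. (\<Sum>i\<in>UNIV. D $ i $ j) = 1"
    then show "matrix_entropy M D \<le> v"
      by (rule bound)
  next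
    fix \<beta> x \<zeta>
    assume "\<And>M D s k. \<lbrakk>\<And>i j. 0 < M $ i $ j; \<And>i j. 0 < D $ i $ j; k \<in> K\<rbrakk> \<Longrightarrow>
        matrix_entropy M D + lagrangian_constraint_part L g \<beta> x \<zeta> M D s k \<le> v"
    then show thesis
      by (rule that)
  qed
  have "0 \<in> K"
    using K by (simp add: convex_cone_iff)
  have "- (1 \<bullet> x) * s
      + (matrix_entropy M0 M0 + lagrangian_constraint_part L g \<beta> x \<zeta> M0 M0 0 0) \<le> v" for s
    using sep[of M0 M0 0 s] \<open>0 \<in> K\<close> slater(1)
    by (simp add: lagrangian_constraint_part_def mult.commute[of s])
  then have "- (1 \<bullet> x) = 0"
    by (rule affine_bounded_imp_slope_zero)
  then have x: "1 \<bullet> x = 0"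
    by simp
  have "0 \<le> k \<bullet> \<zeta>" if "k \<in> K" for k
  proof -
    have "- (k \<bullet> \<zeta>) * s + (matrix_entropy M0 M0 + lagrangian_constraint_part L g \<beta> x \<zeta> M0 M0 0 0) \<le> v"
      if "0 \<le> s" for s
      using sep[of M0 M0 "s *\<^sub>R k" 0] slater(1) convex_cone_scaleR[OF K that \<open>k \<in> K\<close>]
      by (simp add: lagrangian_constraint_part_def inner_diff_right inner_commute algebra_simps)
    then have "- (k \<bullet> \<zeta>) \<le> 0"
      by (rule affine_bounded_imp_slope_nonpos)
    then show ?thesis
      by simp
  qed
  then have \<zeta>: "\<zeta> \<in> dual_cone K"
    by (simp add: dual_cone_def)
  define A where "A i j = adjoint L \<zeta> $ i $ j + exp (x $ j + \<beta> $ i - 1)" for i j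
  have A: "(\<Sum>i\<in>UNIV. \<Sum>j\<in>UNIV. M $ i $ j * A i j) + (g \<bullet> \<zeta> - 1 \<bullet> \<beta>) \<le> v"
    if M: "\<And>i j. 0 < M $ i $ j" for M
  proof -
    \<comment> \<open>The maximizer in \<open>D\<close> of the Lagrangian: entrywise,
      \<open>ln (M / D) - 1 + \<beta> + x = 0\<close>. The bound then becomes affine in
      \<open>M\<close>, with coefficients \<open>A i j\<close>.\<close>
    define D where "D = (\<chi> i j. M $ i $ j * exp (x $ j + \<beta> $ i - 1))"
    have "matrix_entropy M D = (\<Sum>i\<in>UNIV. \<Sum>j\<in>UNIV. D $ i $ j * (1 - (x $ j + \<beta> $ i)))"
      using M by (simp add: matrix_entropy_def D_def less_imp_neq [symmetric] ln_div flip: exp_minus)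
    then have "matrix_entropy M D + (\<Sum>i\<in>UNIV. \<Sum>j\<in>UNIV. (\<beta> $ i + x $ j) * D $ i $ j)
        = (\<Sum>i\<in>UNIV. \<Sum>j\<in>UNIV. D $ i $ j)"
      by (simp add: sum.distrib [symmetric] algebra_simps)
    moreover have "(\<Sum>i\<in>UNIV. \<Sum>j\<in>UNIV. M $ i $ j * A i j)
        = (\<Sum>i\<in>UNIV. \<Sum>j\<in>UNIV. D $ i $ j) + L M \<bullet> \<zeta>"
      by (simp add: inner_adjoint_entries[OF \<open>linear L\<close>] A_def D_def distrib_left sum.distrib)
    moreover have "matrix_entropy M D + lagrangian_constraint_part L g \<beta> x \<zeta> M D 0 0 \<le> v"
      using M \<open>0 \<in> K\<close> by (intro sep) (simp_all add: D_def)
    ultimately show ?thesis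
      by (simp add: lagrangian_constraint_part_def inner_add_right inner_commute)
  qed
  \<comment> \<open>Let one entry of \<open>M\<close> grow while the others stay at
    \<open>1\<close>, since \<open>M\<close> has to be positive.\<close>
  have "A i j \<le> 0" for i j
  proof (rule affine_bounded_imp_slope_nonpos)
    fix s :: real assume "0 \<le> s"
    have "(\<Sum>q\<in>UNIV. (if p = i then if q = j then s else 0 else 0) * A p q)
        = (if p = i then s * A p j else 0)" for p
      by (simp add: if_distrib[of "\<lambda>t. t * _"] cong: if_cong)
    then have "(\<Sum>p\<in>UNIV. \<Sum>q\<in>UNIV. (1 + (if p = i then if q = j then s else 0 else 0)) * A p q)
        = A i j * s + (\<Sum>p\<in>UNIV. \<Sum>q\<in>UNIV. A p q)"
      by (simp add: distrib_right sum.distrib)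
    then show "A i j * s + ((\<Sum>p\<in>UNIV. \<Sum>q\<in>UNIV. A p q) + (g \<bullet> \<zeta> - 1 \<bullet> \<beta>)) \<le> v"
      using A[of "\<chi> p q. 1 + (if p = i then if q = j then s else 0 else 0)"] \<open>0 \<le> s\<close>
      by (simp add: add_pos_nonneg add.assoc)
  qed
  then have "(x, - \<beta>, \<zeta>) \<in> capacity_cgp_feasible L K"
    using x \<zeta> by (simp add: capacity_cgp_feasible_def A_def)
  \<comment> \<open>Take \<open>M\<close> constant and let its common entry tend to \<open>0\<close>
    from above.\<close>
  moreover have "g \<bullet> \<zeta> + 1 \<bullet> (- \<beta>) \<le> v"
    using affine_bounded_imp_intercept_le[of "\<Sum>i\<in>UNIV. \<Sum>j\<in>UNIV. A i j" "g \<bullet> \<zeta> - 1 \<bullet> \<beta>" v]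
      A[of "\<chi> i j. _"]
    by (simp add: sum_distrib_left [symmetric] mult.commute)
  ultimately show ?thesis
    using that by blast
qed

section \<open>The program in conic geometric form, and the duality theorem\<close>

text \<open>An entry of \<open>adjoint L \<zeta>\<close> is the inner product of
  \<open>\<zeta>\<close> with the image under \<open>L\<close> of a matrix unit, which provides the
  linear term \<open>r\<close> of each exponential constraint.\<close>

lemma capacity_cgp_is_conic_geometric_program:
  fixes L :: "real^'n^'n \<Rightarrow> real^'l"
  assumes "linear L"
  shows "conic_geometric_program
           (\<lambda>(x :: real^'n, \<beta> :: real^'n, \<zeta> :: real^'l). g \<bullet> \<zeta> + 1 \<bullet> \<beta>)
           (capacity_cgp_feasible L K)"
proof -
  let ?E = "{((1, 0, 0), 0)} :: (((real^'n) \<times> (real^'n) \<times> (real^'l)) \<times> real) set"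
  let ?K = "{z :: (real^'n) \<times> (real^'n) \<times> (real^'l). snd (snd z) \<in> dual_cone K}"
  let ?G = "range (\<lambda>(i, j). ((axis j 1, - axis i 1, 0), (0, 0, L (axis i (axis j 1))), 1, 0))
    :: (((real^'n) \<times> (real^'n) \<times> (real^'l)) \<times> ((real^'n) \<times> (real^'n) \<times> (real^'l)) \<times> real \<times> real) set"
  have entry: "L (axis i (axis j 1)) \<bullet> \<zeta> = adjoint L \<zeta> $ i $ j" for i j \<zeta>
    using adjoint_works[OF assms, of "axis i (axis j 1)" \<zeta>] by (simp add: inner_axis')
  have "linear (\<lambda>(x :: real^'n, \<beta> :: real^'n, \<zeta> :: real^'l). g \<bullet> \<zeta> + 1 \<bullet> \<beta>)"
    by (rule linearI) (auto simp: algebra_simps inner_add_right)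
  moreover have "convex_cone ?K"
    by (auto simp: convex_cone_iff dual_cone_def inner_add_right)
  moreover have "capacity_cgp_feasible L K =
      {z. (\<forall>(a, b)\<in>?E. a \<bullet> z = b) \<and> z \<in> ?K \<and>
          (\<forall>(q, r, s, t)\<in>?G. exp (q \<bullet> z - s) + r \<bullet> z - t \<le> 0)}"
    by (auto simp: capacity_cgp_feasible_def entry inner_axis' add.commute)
  ultimately show ?thesis
    unfolding conic_geometric_program_def
    by (intro conjI exI[of _ ?E] exI[of _ ?K] exI[of _ ?G]) (simp_all only: finite.intros finite_imageI finite)
qed

theorem proposition7:
  fixes L :: "real^'n^'n \<Rightarrow> real^'l"
    and g :: "real^'l"
    and K :: "(real^'l) set"
    and C :: "(real^'n^'n) set"
  assumes "linear L"
    and "closed K"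
    and "convex_cone K"
    and "C = {M. (\<forall>i j. 0 \<le> M $ i $ j) \<and> g + L M \<in> K}"
    and "compact C"
    and "\<exists>M. (\<forall>i j. 0 < M $ i $ j) \<and> g + L M \<in> interior K"
  shows "conic_geometric_program
           (\<lambda>(x :: real^'n, \<beta> :: real^'n, \<zeta> :: real^'l). g \<bullet> \<zeta> + 1 \<bullet> \<beta>)
           (capacity_cgp_feasible L K) \<and>
         (SUP M\<in>C. capacity (row_product_poly M)) =
         (INF (x, \<beta>, \<zeta>) \<in> capacity_cgp_feasible L K. ereal (exp (g \<bullet> \<zeta> + 1 \<bullet> \<beta>)))"
proof (intro conjI antisym)
  show "conic_geometric_program
           (\<lambda>(x :: real^'n, \<beta> :: real^'n, \<zeta> :: real^'l). g \<bullet> \<zeta> + 1 \<bullet> \<beta>)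
           (capacity_cgp_feasible L K)"
    using \<open>linear L\<close> by (rule capacity_cgp_is_conic_geometric_program)
  let ?sup = "SUP M\<in>C. capacity (row_product_poly M)"
  let ?inf = "INF (x, \<beta>, \<zeta>) \<in> capacity_cgp_feasible L K. ereal (exp (g \<bullet> \<zeta> + 1 \<bullet> \<beta>))"
  show "?sup \<le> ?inf"
    using assms(1,4) by (auto intro!: SUP_least INF_greatest capacity_le_cgp_value)
  show "?inf \<le> ?sup"
  proof -
    have ent: "ereal (exp (matrix_entropy M D)) \<le> ?sup"
      if "\<And>i j. 0 < M $ i $ j" "\<And>i j. 0 < D $ i $ j" "g + L M \<in> K"
        "\<And>i. (\<Sum>j\<in>UNIV. D $ i $ j) = 1" "\<And>j. (\<Sum>i\<in>UNIV. D $ i $ j) = 1" for M D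
      using that assms(4)
      by (intro SUP_upper2[of M] exp_matrix_entropy_le_capacity) (auto intro: less_imp_le)
    obtain M0 where M0: "\<And>i j. 0 < M0 $ i $ j" "g + L M0 \<in> interior K"
      using assms(6) by blast
    \<comment> \<open>The strictly feasible \<open>M0\<close> with the uniform matrix shows that the
      supremum is positive, so its logarithm can serve as the entropy bound.\<close>
    have "ereal (exp (matrix_entropy M0 (\<chi> i j. 1 / real CARD('n)))) \<le> ?sup"
      using M0 interior_subset by (intro ent) auto
    then have pos: "0 < ?sup"
      by (rule less_le_trans[rotated]) simp
    show ?thesis
    \<comment> \<open>An infinite supremum bounds everything, so a dual point is constructed for a
      finite value \<open>V\<close>, with \<open>v = ln V\<close>.\<close>
    proof (cases ?sup)
      case (real V)
      then have "0 < V"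
        using pos by simp
      obtain x \<beta> \<zeta> where "(x, \<beta>, \<zeta>) \<in> capacity_cgp_feasible L K" "g \<bullet> \<zeta> + 1 \<bullet> \<beta> \<le> ln V"
      proof (rule capacity_cgp_dual_point[OF assms(1,3) M0])
        fix M D :: "real^'n^'n"
        assume "\<And>i j. 0 < M $ i $ j" "\<And>i j. 0 < D $ i $ j" "g + L M \<in> K"
          "\<And>i. (\<Sum>j\<in>UNIV. D $ i $ j) = 1" "\<And>j. (\<Sum>i\<in>UNIV. D $ i $ j) = 1"
        from ent[OF this] real \<open>0 < V\<close> show "matrix_entropy M D \<le> ln V"
          by (simp add: ln_ge_iff)
      qed
      moreover from this \<open>0 < V\<close> have "exp (g \<bullet> \<zeta> + 1 \<bullet> \<beta>) \<le> V"
        by (simp add: ln_ge_iff)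
      ultimately show ?thesis
        unfolding real by (intro INF_lower2[of "(x, \<beta>, \<zeta>)"]) auto
    next
      case MInf
      with pos show ?thesis by simp
    qed simp
  qed
qed

end
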